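(* Let $K$ be a symmetric bounded closed convex subset of a Banach space $X$. Let $\mathcal U$ be a countably incomplete ultrafilter on an infinite set $I$. The following assertions are equivalent: (i) $K$ is uniformly convex; (ii) $K_{\mathcal U}$ is uniformly convex. In that case, $\delta_K=\delta_{K_{\mathcal U}}$. Moreover, if $0$ is an interior point of $K$, then the previous statements are equivalent to: (iii) $K_{\mathcal U}$ is strictly convex.
   Context: Banach spaces are real. A free (i.e. non-principal) ultrafilter $\mathcal U$ on a set $I$ is countably incomplete if there is a sequence $(I_n)_{n\in\mathbb N}\subset\mathcal U$ with $\bigcap_n I_n=\emptyset$. The ultrapower is $X_{\mathcal U}=\ell_\infty(I,X)/\{(x_i)_{i\in I}:\lim_{\mathcal U}\|x_i\|=0\}$; the class of $(x_i)_{i\in I}$ is written $(x_i)_{\mathcal U}$ and has norm $\lim_{\mathcal U}\|x_i\|$. For bounded $A\subset X$, $A_{\mathcal U}=\{(x_i)_{\mathcal U}: x_i\in A\ \forall i\in I\}$. Let $C$ be a symmetric bounded closed convex subset of a Banach space, and let $|\cdot|_C$ be its Minkowski functional. $C$ is uniformly convex if for every $\varepsilon>0$ there is $\delta\in(0,1)$ such that for all $x,y\in C$ with $\|x-y\|>\varepsilon$ one has $\frac{x+y}{2}\in(1-\delta)C$. In that case its convexity modulus is $\delta_C(\varepsilon)=\inf\{1-|\frac{x+y}{2}|_C: x,y\in C,\ \|x-y\|>\varepsilon\}$ for $\varepsilon>0$, with $\inf\emptyset=1$. $C$ is strictly convex if for all $x,y\in C$ with $x\neq y$ and $|x|_C=|y|_C=1$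 one has $|\frac{x+y}{2}|_C<1$. *)

theory Defs
  imports "HOL-Analysis.Analysis"
begin

(* Real normed spaces with an explicit carrier. An ultrapower depends on the ultrafilter, which is
   a term, so it cannot be a HOL type; the convexity notions below are therefore stated once for
   this record and used both for a type of class real_normed_vector and for its ultrapowers. *)

record 'v normed_space =
  vcarrier :: "'v set"
  vadd :: "'v \<Rightarrow> 'v \<Rightarrow> 'v"
  vscale :: "real \<Rightarrow> 'v \<Rightarrow> 'v"
  vnorm :: "'v \<Rightarrow> real"

definition type_space :: "'a::real_normed_vector normed_space" where
  "type_space = \<lparr>vcarrier = UNIV, vadd = (+), vscale = (*\<^sub>R), vnorm = norm\<rparr>"

definition vdiff :: "'v normed_space \<Rightarrow> 'v \<Rightarrow> 'v \<Rightarrow> 'v" where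
  "vdiff S x y = vadd S x (vscale S (-1) y)"

definition vmidpoint :: "'v normed_space \<Rightarrow> 'v \<Rightarrow> 'v \<Rightarrow> 'v" where
  "vmidpoint S x y = vscale S (1/2) (vadd S x y)"

(* Real valued, so meaningful only on the linear span of C (it should be infinite elsewhere).
   Below it is evaluated only at points of the convex set C, where it is at most 1. *)

definition minkowski :: "'v normed_space \<Rightarrow> 'v set \<Rightarrow> 'v \<Rightarrow> real" where
  "minkowski S C x = Inf {t. t > 0 \<and> x \<in> vscale S t ` C}"

definition uniformly_convex :: "'v normed_space \<Rightarrow> 'v set \<Rightarrow> bool" where
  "uniformly_convex S C \<longleftrightarrow>
     (\<forall>\<epsilon>>0. \<exists>\<delta>. 0 < \<delta> \<and> \<delta> < 1 \<and>
        (\<forall>x\<in>C. \<forall>y\<in>C. vnorm S (vdiff S x y) > \<epsilon> \<longrightarrow> vmidpoint S x y \<in> vscale S (1 - \<delta>) ` C))"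

(* The case distinction is the convention that the infimum of the empty set is 1. *)

definition convexity_modulus :: "'v normed_space \<Rightarrow> 'v set \<Rightarrow> real \<Rightarrow> real" where
  "convexity_modulus S C \<epsilon> =
     (let D = {1 - minkowski S C (vmidpoint S x y) | x y.
                 x \<in> C \<and> y \<in> C \<and> vnorm S (vdiff S x y) > \<epsilon>}
      in if D = {} then 1 else Inf D)"

definition strictly_convex :: "'v normed_space \<Rightarrow> 'v set \<Rightarrow> bool" where
  "strictly_convex S C \<longleftrightarrow>
     (\<forall>x\<in>C. \<forall>y\<in>C. x \<noteq> y \<and> minkowski S C x = 1 \<and> minkowski S C y = 1 \<longrightarrow>
        minkowski S C (vmidpoint S x y) < 1)"

(* Ultrafilters on the index set I are filters on a type 'i, with I = UNIV; membership of A in U is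
   "eventually (\<lambda>i. i \<in> A) U". *)

definition ultrafilter :: "'i filter \<Rightarrow> bool" where
  "ultrafilter U \<longleftrightarrow>
     U \<noteq> bot \<and> (\<forall>A. eventually (\<lambda>i. i \<in> A) U \<or> eventually (\<lambda>i. i \<in> - A) U)"

definition free_ultrafilter :: "'i filter \<Rightarrow> bool" where
  "free_ultrafilter U \<longleftrightarrow> ultrafilter U \<and> (\<forall>i. U \<noteq> principal {i})"

definition countably_incomplete_ultrafilter :: "'i filter \<Rightarrow> bool" where
  "countably_incomplete_ultrafilter U \<longleftrightarrow>
     free_ultrafilter U \<and>
     (\<exists>A :: nat \<Rightarrow> 'i set. (\<forall>n. eventually (\<lambda>i. i \<in> A n) U) \<and> (\<Inter>n. A n) = {})"

definition ell_infty :: "('i \<Rightarrow> 'a::real_normed_vector) set" where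
  "ell_infty = {x. bounded (range x)}"

definition ultra_rel ::
    "'i filter \<Rightarrow> (('i \<Rightarrow> 'a::real_normed_vector) \<times> ('i \<Rightarrow> 'a)) set" where
  "ultra_rel U =
     {(x, y). x \<in> ell_infty \<and> y \<in> ell_infty \<and> ((\<lambda>i. norm (x i - y i)) \<longlongrightarrow> 0) U}"

definition ultra_class ::
    "'i filter \<Rightarrow> ('i \<Rightarrow> 'a::real_normed_vector) \<Rightarrow> ('i \<Rightarrow> 'a) set" where
  "ultra_class U x = ultra_rel U `` {x}"

(* The union or image over representatives is a union of equal classes or a singleton; see
   ultrapower_add, ultrapower_scale and ultrapower_norm below. *)

definition ultrapower :: "'i filter \<Rightarrow> ('i \<Rightarrow> 'a::real_normed_vector) set normed_space" where
  "ultrapower U =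
     \<lparr>vcarrier = ell_infty // ultra_rel U,
      vadd = (\<lambda>A B. \<Union>x\<in>A. \<Union>y\<in>B. ultra_class U (\<lambda>i. x i + y i)),
      vscale = (\<lambda>r A. \<Union>x\<in>A. ultra_class U (\<lambda>i. r *\<^sub>R x i)),
      vnorm = (\<lambda>A. the_elem ((\<lambda>x. Lim U (\<lambda>i. norm (x i))) ` A))\<rparr>"

definition ultra_set ::
    "'i filter \<Rightarrow> 'a::real_normed_vector set \<Rightarrow> ('i \<Rightarrow> 'a) set set" where
  "ultra_set U A = {ultra_class U x | x. \<forall>i. x i \<in> A}"

lemma ell_infty_add: "x \<in> ell_infty \<Longrightarrow> y \<in> ell_infty \<Longrightarrow> (\<lambda>i. x i + y i) \<in> ell_infty"
  unfolding ell_infty_def by (auto intro: bounded_plus_comp)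

lemma ell_infty_scale: "x \<in> ell_infty \<Longrightarrow> (\<lambda>i. r *\<^sub>R x i) \<in> ell_infty"
  unfolding ell_infty_def by (auto intro: bounded_scaleR_comp)

lemma equiv_ultra_rel:
  "equiv (ell_infty :: ('i \<Rightarrow> 'a::real_normed_vector) set) (ultra_rel U)"
proof (rule equivI)
  show "ultra_rel U \<subseteq> (ell_infty :: ('i \<Rightarrow> 'a) set) \<times> ell_infty"
    by (auto simp: ultra_rel_def)
  show "refl_on (ell_infty :: ('i \<Rightarrow> 'a) set) (ultra_rel U)"
    by (auto simp: refl_on_def ultra_rel_def)
  show "sym (ultra_rel U :: (('i \<Rightarrow> 'a) \<times> _) set)"
    by (auto simp: sym_def ultra_rel_def norm_minus_commute)
  show "trans (ultra_rel U :: (('i \<Rightarrow> 'a) \<times> _) set)"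
  proof (rule transI)
    fix x y z :: "'i \<Rightarrow> 'a"
    assume xy: "(x, y) \<in> ultra_rel U" and yz: "(y, z) \<in> ultra_rel U"
    have "((\<lambda>i. (x i - y i) + (y i - z i)) \<longlongrightarrow> 0 + 0) U"
      by (rule tendsto_add) (use xy yz in \<open>auto simp: ultra_rel_def tendsto_norm_zero_iff\<close>)
    then show "(x, z) \<in> ultra_rel U"
      using xy yz by (auto simp: ultra_rel_def tendsto_norm_zero_iff)
  qed
qed

lemma mem_ultra_class:
  "y \<in> ultra_class U x \<longleftrightarrow>
     x \<in> ell_infty \<and> y \<in> ell_infty \<and> ((\<lambda>i. x i - y i) \<longlongrightarrow> 0) U"
  by (auto simp: ultra_class_def ultra_rel_def tendsto_norm_zero_iff)

lemma ultra_class_self: "x \<in> ell_infty \<Longrightarrow> x \<in> ultra_class U x"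
  by (simp add: mem_ultra_class)

lemma ultra_class_eqI:
  assumes "y \<in> ultra_class U x" shows "ultra_class U y = ultra_class U x"
  using equiv_class_eq[OF equiv_ultra_rel] assms by (fastforce simp: ultra_class_def)

lemma ultrapower_add:
  assumes x: "x \<in> ell_infty" and y: "y \<in> ell_infty"
  shows "vadd (ultrapower U) (ultra_class U x) (ultra_class U y) =
    ultra_class U (\<lambda>i. x i + y i)"
proof -
  have eq: "ultra_class U (\<lambda>i. x' i + y' i) = ultra_class U (\<lambda>i. x i + y i)"
    if x': "x' \<in> ultra_class U x" and y': "y' \<in> ultra_class U y" for x' y'
  proof (rule ultra_class_eqI)
    have "((\<lambda>i. (x i - x' i) + (y i - y' i)) \<longlongrightarrow> 0 + 0) U"
      by (rule tendsto_add) (use x' y' in \<open>auto simp: mem_ultra_class\<close>)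
    then show "(\<lambda>i. x' i + y' i) \<in> ultra_class U (\<lambda>i. x i + y i)"
      using x' y' by (auto simp: mem_ultra_class ell_infty_add algebra_simps)
  qed
  have "(\<Union>x'\<in>ultra_class U x. \<Union>y'\<in>ultra_class U y. ultra_class U (\<lambda>i. x' i + y' i)) =
      (\<Union>x'\<in>ultra_class U x. \<Union>y'\<in>ultra_class U y. ultra_class U (\<lambda>i. x i + y i))"
    by (intro SUP_cong refl eq)
  also have "\<dots> = ultra_class U (\<lambda>i. x i + y i)"
    using ultra_class_self[OF x, of U] ultra_class_self[OF y, of U] by blast
  finally show ?thesis
    by (simp add: ultrapower_def)
qed

lemma ultrapower_scale:
  assumes x: "x \<in> ell_infty"
  shows "vscale (ultrapower U) r (ultra_class U x) = ultra_class U (\<lambda>i. r *\<^sub>R x i)"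
proof -
  have eq: "ultra_class U (\<lambda>i. r *\<^sub>R x' i) = ultra_class U (\<lambda>i. r *\<^sub>R x i)"
    if x': "x' \<in> ultra_class U x" for x'
  proof (rule ultra_class_eqI)
    have "((\<lambda>i. r *\<^sub>R (x i - x' i)) \<longlongrightarrow> r *\<^sub>R 0) U"
      by (rule tendsto_scaleR) (use x' in \<open>auto simp: mem_ultra_class\<close>)
    then show "(\<lambda>i. r *\<^sub>R x' i) \<in> ultra_class U (\<lambda>i. r *\<^sub>R x i)"
      using x' by (auto simp: mem_ultra_class ell_infty_scale algebra_simps)
  qed
  have "(\<Union>x'\<in>ultra_class U x. ultra_class U (\<lambda>i. r *\<^sub>R x' i)) =
      (\<Union>x'\<in>ultra_class U x. ultra_class U (\<lambda>i. r *\<^sub>R x i))"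
    by (intro SUP_cong refl eq)
  also have "\<dots> = ultra_class U (\<lambda>i. r *\<^sub>R x i)"
    using ultra_class_self[OF x, of U] by blast
  finally show ?thesis
    by (simp add: ultrapower_def)
qed

lemma ultrafilter_limit_exists:
  fixes f :: "'i \<Rightarrow> real"
  assumes U: "ultrafilter U" and f: "bounded (range f)"
  shows "\<exists>l. (f \<longlongrightarrow> l) U"
proof -
  have c: "compact (closure (range f))"
    using f by simp
  have nb: "filtermap f U \<noteq> bot"
    using U by (simp add: ultrafilter_def filtermap_bot_iff)
  have ev: "eventually (\<lambda>y. y \<in> closure (range f)) (filtermap f U)"
    unfolding eventually_filtermap using closure_subset[of "range f"]
    by (intro always_eventually) auto
  obtain l where l: "inf (nhds l) (filtermap f U) \<noteq> bot"
    using c[unfolded compact_filter, rule_format, OF nb ev] by auto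
  have "(f \<longlongrightarrow> l) U"
  proof (rule topological_tendstoI)
    fix S assume S: "open S" "l \<in> S"
    have "eventually (\<lambda>i. i \<in> f -` S) U \<or> eventually (\<lambda>i. i \<in> - (f -` S)) U"
      using U unfolding ultrafilter_def by blast
    moreover have False if "eventually (\<lambda>i. i \<in> - (f -` S)) U"
    proof -
      have 1: "eventually (\<lambda>y. y \<notin> S) (filtermap f U)"
        using that by (simp add: eventually_filtermap)
      have 2: "eventually (\<lambda>y. y \<in> S) (nhds l)"
        using S by (rule eventually_nhds_in_open)
      have "eventually (\<lambda>y. False) (inf (nhds l) (filtermap f U))"
        unfolding eventually_inf
        by (rule exI[of _ "\<lambda>y. y \<in> S"], rule exI[of _ "\<lambda>y. y \<notin> S"]) (use 1 2 in simp)
      then show False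
        using l by (simp add: eventually_False)
    qed
    ultimately show "eventually (\<lambda>i. f i \<in> S) U"
      by auto
  qed
  then show ?thesis ..
qed

lemma ultrapower_norm:
  assumes U: "ultrafilter U" and x: "x \<in> ell_infty"
  shows "vnorm (ultrapower U) (ultra_class U x) = Lim U (\<lambda>i. norm (x i))"
    and "((\<lambda>i. norm (x i)) \<longlongrightarrow> vnorm (ultrapower U) (ultra_class U x)) U"
proof -
  have nb: "U \<noteq> bot"
    using U by (simp add: ultrafilter_def)
  have "bounded (range (\<lambda>i. norm (x i)))"
    using x by (simp add: ell_infty_def bounded_norm_comp)
  then obtain l where l: "((\<lambda>i. norm (x i)) \<longlongrightarrow> l) U"
    using ultrafilter_limit_exists[OF U] by blast
  have Lim: "Lim U (\<lambda>i. norm (x' i)) = l" if x': "x' \<in> ultra_class U x" for x'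
  proof -
    have "((\<lambda>i. norm (x' i) - norm (x i)) \<longlongrightarrow> 0) U"
    proof (rule Lim_null_comparison)
      show "eventually (\<lambda>i. norm (norm (x' i) - norm (x i)) \<le> norm (x i - x' i)) U"
        unfolding real_norm_def
        by (intro always_eventually allI) (subst norm_minus_commute, rule norm_triangle_ineq3)
      show "((\<lambda>i. norm (x i - x' i)) \<longlongrightarrow> 0) U"
        using x' by (simp add: mem_ultra_class tendsto_norm_zero_iff)
    qed
    from tendsto_add[OF this l] have "((\<lambda>i. norm (x' i)) \<longlongrightarrow> l) U"
      by simp
    then show ?thesis
      using nb by (simp add: tendsto_Lim)
  qed
  have "(\<lambda>x. Lim U (\<lambda>i. norm (x i))) ` ultra_class U x = {l}"
    using Lim ultra_class_self[OF x, of U] by auto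
  then have n: "vnorm (ultrapower U) (ultra_class U x) = l"
    by (simp add: ultrapower_def)
  show "vnorm (ultrapower U) (ultra_class U x) = Lim U (\<lambda>i. norm (x i))"
    using n Lim ultra_class_self[OF x, of U] by simp
  show "((\<lambda>i. norm (x i)) \<longlongrightarrow> vnorm (ultrapower U) (ultra_class U x)) U"
    using n l by simp
qed

end

theory Submission
  imports Defs
begin

text \<open>
  A point lies in \<open>t K\<^sub>U\<close> if U-almost all coordinates of a representative lie in \<open>t K\<close>, and since
  \<open>K\<close> is closed the converse holds for constant families. The first fact transfers estimates on
  midpoints from \<open>K\<close> to \<open>K\<^sub>U\<close>, the second transfers them back along the diagonal embedding, which
  preserves the norm and the Minkowski functional; this settles (i), (ii) and the moduli.
  If \<open>K\<close> is not uniformly convex, countable incompleteness assembles pairs \<open>x\<^sub>n, y\<^sub>n\<close> violating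
  uniform convexity with \<open>\<delta> = 1 / (n + 2)\<close> into two distinct points of \<open>K\<^sub>U\<close>. When \<open>0\<close> is interior
  to \<open>K\<close>, infinitesimal perturbations are absorbed by small multiples of \<open>K\<close>, so the midpoint
  of these points still has gauge 1, and \<open>K\<^sub>U\<close> is not strictly convex.
\<close>

section \<open>Representatives and vector operations in the ultrapower\<close>

lemma type_space_simps [simp]:
  "vnorm type_space = norm" "vscale type_space = (*\<^sub>R)" "vadd type_space = (+)"
  "vdiff type_space x y = x - y" "vmidpoint type_space x y = (1/2) *\<^sub>R (x + y)"
  by (simp_all add: type_space_def vdiff_def vmidpoint_def)

lemma bounded_imp_ell_infty:
  assumes "bounded K" "\<And>i. x i \<in> K"
  shows "x \<in> ell_infty"
  unfolding ell_infty_def using assms by (auto intro: bounded_subset)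

lemma ultra_class_eq_iff:
  assumes "x \<in> ell_infty" "y \<in> ell_infty"
  shows "ultra_class U x = ultra_class U y \<longleftrightarrow> ((\<lambda>i. x i - y i) \<longlongrightarrow> 0) U"
  using assms ultra_class_self[OF assms(2), of U] ultra_class_eqI[of y U x]
  by (auto simp: mem_ultra_class)

lemma ultrapower_diff:
  assumes x: "x \<in> ell_infty" and y: "y \<in> ell_infty"
  shows "vdiff (ultrapower U) (ultra_class U x) (ultra_class U y) = ultra_class U (\<lambda>i. x i - y i)"
  using ultrapower_add[OF x ell_infty_scale[OF y, of "-1"], of U]
  by (simp add: vdiff_def ultrapower_scale[OF y])

lemma ultrapower_midpoint:
  assumes x: "x \<in> ell_infty" and y: "y \<in> ell_infty"
  shows "vmidpoint (ultrapower U) (ultra_class U x) (ultra_class U y) =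
    ultra_class U (\<lambda>i. (1/2) *\<^sub>R (x i + y i))"
  by (simp add: vmidpoint_def ultrapower_add[OF x y] ultrapower_scale[OF ell_infty_add[OF x y]])

lemma ell_infty_diff:
  assumes "x \<in> ell_infty" "y \<in> ell_infty"
  shows "(\<lambda>i. x i - y i) \<in> ell_infty"
  using ell_infty_add[OF assms(1) ell_infty_scale[OF assms(2), of "-1"]] by simp

text \<open>A strict lower bound is an open condition on the limit of the norms, so it passes to
  \<open>U\<close>-almost all coordinates. This fits the strict \<open>> \<epsilon>\<close> in the
  definitions of uniform convexity and of the modulus.\<close>

lemma eventually_ultrapower_norm_diff_less:
  assumes U: "ultrafilter U" and xy: "x \<in> ell_infty" "y \<in> ell_infty"
    and less: "\<epsilon> < vnorm (ultrapower U) (vdiff (ultrapower U) (ultra_class U x) (ultra_class U y))"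
  shows "\<forall>\<^sub>F i in U. \<epsilon> < norm (x i - y i)"
  using order_tendstoD(1)[OF ultrapower_norm(2)[OF U ell_infty_diff[OF xy]]] less
  by (simp add: ultrapower_diff[OF xy])

section \<open>Dilates of \<open>ultra_set U K\<close> in terms of representatives\<close>

text \<open>Each point of \<open>ultra_set U K\<close> has a representative with all coordinates in
  \<open>K\<close>, and two classes agree when the difference tends to 0 along \<open>U\<close>.
  Membership thus becomes a statement about families of vectors.\<close>

lemma ultra_class_mem_scaled_iff:
  assumes K: "bounded K" and z: "z \<in> ell_infty"
  shows "ultra_class U z \<in> vscale (ultrapower U) t ` ultra_set U K \<longleftrightarrow>
    (\<exists>w. (\<forall>i. w i \<in> K) \<and> ((\<lambda>i. z i - t *\<^sub>R w i) \<longlongrightarrow> 0) U)"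
proof -
  have w: "w \<in> ell_infty" if "\<forall>i. w i \<in> K" for w :: "'b \<Rightarrow> 'a"
    using bounded_imp_ell_infty[OF K] that by blast
  have "ultra_class U z \<in> vscale (ultrapower U) t ` ultra_set U K \<longleftrightarrow>
      (\<exists>w. (\<forall>i. w i \<in> K) \<and> ultra_class U z = vscale (ultrapower U) t (ultra_class U w))"
    by (auto simp: ultra_set_def)
  also have "\<dots> \<longleftrightarrow> (\<exists>w. (\<forall>i. w i \<in> K) \<and> ((\<lambda>i. z i - t *\<^sub>R w i) \<longlongrightarrow> 0) U)"
    by (intro ex_cong1 conj_cong refl)
      (simp add: ultrapower_scale[OF w] ultra_class_eq_iff[OF z ell_infty_scale[OF w]])
  finally show ?thesis .
qed

text \<open>The exceptional coordinates of \<open>w\<close> can be filled with an arbitrary point of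
  \<open>K\<close>, since \<open>U\<close>-almost all coordinates determine the class.\<close>

lemma ultra_class_mem_scaledI:
  assumes K: "bounded K" and z: "z \<in> ell_infty" and ne: "K \<noteq> {}"
    and ev: "\<forall>\<^sub>F i in U. z i \<in> (*\<^sub>R) t ` K"
  shows "ultra_class U z \<in> vscale (ultrapower U) t ` ultra_set U K"
proof -
  have "\<exists>v. v \<in> K \<and> (z i \<in> (*\<^sub>R) t ` K \<longrightarrow> z i = t *\<^sub>R v)" for i
    using ne by blast
  then obtain w where w: "\<And>i. w i \<in> K" "\<And>i. z i \<in> (*\<^sub>R) t ` K \<Longrightarrow> z i = t *\<^sub>R w i"
    by metis
  have "((\<lambda>i. z i - t *\<^sub>R w i) \<longlongrightarrow> 0) U"
    by (rule tendsto_eventually) (use ev w(2) in \<open>auto elim!: eventually_mono\<close>)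
  with w(1) show ?thesis
    unfolding ultra_class_mem_scaled_iff[OF K z] by blast
qed

section \<open>The diagonal embedding by constant families\<close>

lemma const_ell_infty: "(\<lambda>_. z) \<in> ell_infty"
  by (simp add: ell_infty_def)

text \<open>The family \<open>w\<close> in \<open>K\<close> converges along \<open>U\<close> to
  \<open>inverse t *\<^sub>R z\<close>, and closedness keeps this limit in \<open>K\<close>.\<close>

lemma const_ultra_class_mem_scaled_iff:
  assumes K: "bounded K" "closed K" and U: "U \<noteq> bot" and t: "t > 0"
  shows "ultra_class U (\<lambda>_. z) \<in> vscale (ultrapower U) t ` ultra_set U K \<longleftrightarrow> z \<in> (*\<^sub>R) t ` K"
proof
  assume "ultra_class U (\<lambda>_. z) \<in> vscale (ultrapower U) t ` ultra_set U K"
  then obtain w where w: "\<forall>i. w i \<in> K" and lim: "((\<lambda>i. z - t *\<^sub>R w i) \<longlongrightarrow> 0) U"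
    by (auto simp: ultra_class_mem_scaled_iff[OF K(1) const_ell_infty])
  \<comment> \<open>Solves for \<open>w i\<close>: the expression being scaled equals
    \<open>t *\<^sub>R w i\<close>.\<close>
  have "((\<lambda>i. inverse t *\<^sub>R (z - (z - t *\<^sub>R w i))) \<longlongrightarrow> inverse t *\<^sub>R (z - 0)) U"
    by (intro tendsto_intros lim)
  then have "(w \<longlongrightarrow> inverse t *\<^sub>R z) U"
    using t by simp
  then have "inverse t *\<^sub>R z \<in> K"
    by (rule Lim_in_closed_set[OF K(2) _ U, rotated]) (use w in simp)
  then show "z \<in> (*\<^sub>R) t ` K"
    using t by (intro image_eqI[of _ _ "inverse t *\<^sub>R z"]) auto
next
  assume "z \<in> (*\<^sub>R) t ` K"
  then show "ultra_class U (\<lambda>_. z) \<in> vscale (ultrapower U) t ` ultra_set U K"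
    by (intro ultra_class_mem_scaledI[OF K(1) const_ell_infty]) auto
qed

lemma const_ultra_class_minkowski:
  assumes "bounded K" "closed K" "U \<noteq> bot"
  shows "minkowski (ultrapower U) (ultra_set U K) (ultra_class U (\<lambda>_. z)) =
    minkowski type_space K z"
  unfolding minkowski_def
  by (intro arg_cong[where f = Inf] Collect_cong conj_cong refl)
    (simp add: const_ultra_class_mem_scaled_iff[OF assms])

lemma const_ultra_class_norm_diff:
  assumes U: "ultrafilter U"
  shows "vnorm (ultrapower U)
      (vdiff (ultrapower U) (ultra_class U (\<lambda>_. x)) (ultra_class U (\<lambda>_. y))) = norm (x - y)"
  using U ultrapower_norm(1)[OF U const_ell_infty, of "x - y"]
  by (simp add: ultrapower_diff[OF const_ell_infty const_ell_infty] tendsto_Lim ultrafilter_def)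

section \<open>The Minkowski functional and dilates of convex sets\<close>

lemma minkowski_le:
  assumes "t > 0" "x \<in> vscale S t ` C"
  shows "minkowski S C x \<le> t"
  unfolding minkowski_def
  by (rule cInf_lower) (use assms in \<open>auto intro!: bdd_belowI[of _ 0]\<close>)

text \<open>The scalar \<open>s\<close> only shows that the infimum is over a nonempty set; the
  infimum itself need not be attained.\<close>

lemma minkowski_less_obtain:
  assumes "minkowski S C x < c" "s > 0" "x \<in> vscale S s ` C"
  obtains t where "0 < t" "t < c" "x \<in> vscale S t ` C"
proof -
  have "{t. t > 0 \<and> x \<in> vscale S t ` C} \<noteq> {}"
    using assms by auto
  from cInf_lessD[OF this assms(1)[unfolded minkowski_def]] that show ?thesis
    by auto
qed

lemma minkowski_nonneg:
  assumes "s > 0" "x \<in> vscale S s ` C"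
  shows "0 \<le> minkowski S C x"
  unfolding minkowski_def by (rule cInf_greatest) (use assms in auto)

text \<open>For \<open>t > 0\<close>, dividing by \<open>t\<close> turns a point of
  \<open>s K\<close> into a convex combination of a point of \<open>K\<close> and 0.\<close>

lemma scaled_convex_mono:
  fixes K :: "'a::real_vector set"
  assumes K: "convex K" "0 \<in> K" and st: "0 \<le> s" "s \<le> t" and x: "x \<in> (*\<^sub>R) s ` K"
  shows "x \<in> (*\<^sub>R) t ` K"
proof (cases "t = 0")
  case False
  obtain k where k: "k \<in> K" "x = s *\<^sub>R k"
    using x by blast
  have "(s / t) *\<^sub>R k + (1 - s / t) *\<^sub>R 0 \<in> K"
    using K k st False by (intro convexD[OF K(1)]) auto
  then show ?thesis
    using k False by (intro image_eqI[of _ _ "(s / t) *\<^sub>R k"]) auto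
qed (use st x in auto)

text \<open>Dividing by \<open>s + t\<close> turns the sum into a convex combination of
  \<open>u\<close> and \<open>v\<close>.\<close>

lemma scaled_convex_add:
  fixes K :: "'a::real_vector set"
  assumes K: "convex K" and st: "0 < s" "0 < t" and uv: "u \<in> K" "v \<in> K"
  shows "s *\<^sub>R u + t *\<^sub>R v \<in> (*\<^sub>R) (s + t) ` K"
proof -
  have "(s / (s + t)) *\<^sub>R u + (t / (s + t)) *\<^sub>R v \<in> K"
    using st by (intro convexD[OF K uv]) (auto simp: add_divide_distrib[symmetric])
  moreover have "s *\<^sub>R u + t *\<^sub>R v = (s + t) *\<^sub>R ((s / (s + t)) *\<^sub>R u + (t / (s + t)) *\<^sub>R v)"
    using st by (simp add: scaleR_add_right)
  ultimately show ?thesis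
    by (metis imageI)
qed

lemma convex_midpoint_mem:
  fixes K :: "'a::real_vector set"
  assumes "convex K" "x \<in> K" "y \<in> K"
  shows "(1/2) *\<^sub>R (x + y) \<in> K"
  using convexD[OF assms, of "1/2" "1/2"] by (simp add: scaleR_add_right)

lemma ultra_setE:
  assumes "bounded K" "X \<in> ultra_set U K"
  obtains x where "\<And>i. x i \<in> K" "x \<in> ell_infty" "X = ultra_class U x"
  using assms by (auto simp: ultra_set_def intro: bounded_imp_ell_infty)

lemma ultra_class_mem: "(\<And>i. x i \<in> K) \<Longrightarrow> ultra_class U x \<in> ultra_set U K"
  by (auto simp: ultra_set_def)

text \<open>Provides 1 as an admissible scalar, so that the gauge is at most 1 on
  \<open>ultra_set U K\<close>.\<close>

lemma ultra_set_scale_one: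
  assumes "bounded K" "X \<in> ultra_set U K"
  shows "X \<in> vscale (ultrapower U) 1 ` ultra_set U K"
proof -
  obtain x where x: "\<And>i. x i \<in> K" "x \<in> ell_infty" "X = ultra_class U x"
    using ultra_setE[OF assms] by blast
  then show ?thesis
    using ultrapower_scale[OF x(2), of U 1] assms(2) by force
qed

section \<open>Transfer of uniform convexity\<close>

text \<open>The same \<open>\<delta>\<close> serves in both directions: constant families bring it
  down to \<open>K\<close>, coordinatewise midpoints bring it up to
  \<open>ultra_set U K\<close>.\<close>

lemma uniformly_convex_ultrapower_iff:
  fixes K :: "'a::real_normed_vector set"
  assumes K: "bounded K" "closed K" and U: "ultrafilter U"
  shows "uniformly_convex (ultrapower U) (ultra_set U K) \<longleftrightarrow> uniformly_convex type_space K"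
proof
  have nb: "U \<noteq> bot"
    using U by (simp add: ultrafilter_def)
  assume uc: "uniformly_convex (ultrapower U) (ultra_set U K)"
  show "uniformly_convex type_space K"
    unfolding uniformly_convex_def
  proof (intro allI impI)
    fix \<epsilon> :: real assume "\<epsilon> > 0"
    then obtain \<delta> where \<delta>: "0 < \<delta>" "\<delta> < 1" and
      mid: "\<And>X Y. \<lbrakk>X \<in> ultra_set U K; Y \<in> ultra_set U K;
          vnorm (ultrapower U) (vdiff (ultrapower U) X Y) > \<epsilon>\<rbrakk> \<Longrightarrow>
          vmidpoint (ultrapower U) X Y \<in> vscale (ultrapower U) (1 - \<delta>) ` ultra_set U K"
      using uc unfolding uniformly_convex_def by meson
    have "(1/2) *\<^sub>R (x + y) \<in> (*\<^sub>R) (1 - \<delta>) ` K" if "x \<in> K" "y \<in> K" "norm (x - y) > \<epsilon>" for x y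
      using mid[of "ultra_class U (\<lambda>_. x)" "ultra_class U (\<lambda>_. y)"] that \<delta>
      by (simp add: ultra_class_mem const_ultra_class_norm_diff[OF U]
          ultrapower_midpoint[OF const_ell_infty const_ell_infty]
          const_ultra_class_mem_scaled_iff[OF K nb])
    with \<delta> show "\<exists>\<delta>. 0 < \<delta> \<and> \<delta> < 1 \<and> (\<forall>x\<in>K. \<forall>y\<in>K. vnorm type_space (vdiff type_space x y) > \<epsilon>
        \<longrightarrow> vmidpoint type_space x y \<in> vscale type_space (1 - \<delta>) ` K)"
      by auto
  qed
next
  assume uc: "uniformly_convex type_space K"
  show "uniformly_convex (ultrapower U) (ultra_set U K)"
    unfolding uniformly_convex_def
  proof (intro allI impI)
    fix \<epsilon> :: real assume "\<epsilon> > 0"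
    then obtain \<delta> where \<delta>: "0 < \<delta>" "\<delta> < 1" and
      mid: "\<And>x y. \<lbrakk>x \<in> K; y \<in> K; norm (x - y) > \<epsilon>\<rbrakk> \<Longrightarrow> (1/2) *\<^sub>R (x + y) \<in> (*\<^sub>R) (1 - \<delta>) ` K"
      using uc unfolding uniformly_convex_def type_space_simps by meson
    have "vmidpoint (ultrapower U) X Y \<in> vscale (ultrapower U) (1 - \<delta>) ` ultra_set U K"
      if X: "X \<in> ultra_set U K" and Y: "Y \<in> ultra_set U K"
        and less: "vnorm (ultrapower U) (vdiff (ultrapower U) X Y) > \<epsilon>" for X Y
    proof -
      obtain x where x: "\<And>i. x i \<in> K" "x \<in> ell_infty" "X = ultra_class U x"
        using ultra_setE[OF K(1) X] by blast
      obtain y where y: "\<And>i. y i \<in> K" "y \<in> ell_infty" "Y = ultra_class U y"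
        using ultra_setE[OF K(1) Y] by blast
      have "\<forall>\<^sub>F i in U. (1/2) *\<^sub>R (x i + y i) \<in> (*\<^sub>R) (1 - \<delta>) ` K"
        using eventually_ultrapower_norm_diff_less[OF U x(2) y(2) less[unfolded x(3) y(3)]]
        by (rule eventually_mono) (intro mid x y)
      moreover have "K \<noteq> {}"
        using x(1) by auto
      ultimately show ?thesis
        unfolding x(3) y(3) ultrapower_midpoint[OF x(2) y(2)]
        by (intro ultra_class_mem_scaledI K ell_infty_scale ell_infty_add x y)
    qed
    with \<delta> show "\<exists>\<delta>. 0 < \<delta> \<and> \<delta> < 1 \<and> (\<forall>X\<in>ultra_set U K. \<forall>Y\<in>ultra_set U K.
        vnorm (ultrapower U) (vdiff (ultrapower U) X Y) > \<epsilon> \<longrightarrow>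
        vmidpoint (ultrapower U) X Y \<in> vscale (ultrapower U) (1 - \<delta>) ` ultra_set U K)"
      by auto
  qed
qed

section \<open>Equality of the convexity moduli\<close>

text \<open>Constant families show that every value in \<open>D\<close> occurs in \<open>E\<close>.
  Conversely, no value in \<open>E\<close> falls below \<open>Inf D\<close>, so the infima agree
  even if \<open>E\<close> is larger.\<close>

lemma convexity_modulus_ultrapower:
  fixes K :: "'a::real_normed_vector set"
  assumes sym: "\<forall>x\<in>K. - x \<in> K" and K: "bounded K" "closed K" "convex K" and U: "ultrafilter U"
  shows "convexity_modulus (ultrapower U) (ultra_set U K) \<epsilon> = convexity_modulus type_space K \<epsilon>"
proof -
  have nb: "U \<noteq> bot"
    using U by (simp add: ultrafilter_def)
  define D where "D = {1 - minkowski type_space K ((1/2) *\<^sub>R (x + y)) | x y.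
    x \<in> K \<and> y \<in> K \<and> norm (x - y) > \<epsilon>}"
  define E where "E = {1 - minkowski (ultrapower U) (ultra_set U K) (vmidpoint (ultrapower U) X Y) | X Y.
    X \<in> ultra_set U K \<and> Y \<in> ultra_set U K \<and> vnorm (ultrapower U) (vdiff (ultrapower U) X Y) > \<epsilon>}"
  have DE: "D \<subseteq> E"
  proof
    fix d assume "d \<in> D"
    then obtain x y where xy: "x \<in> K" "y \<in> K" "norm (x - y) > \<epsilon>"
      and d: "d = 1 - minkowski type_space K ((1/2) *\<^sub>R (x + y))"
      unfolding D_def by blast
    have "d = 1 - minkowski (ultrapower U) (ultra_set U K)
        (vmidpoint (ultrapower U) (ultra_class U (\<lambda>_. x)) (ultra_class U (\<lambda>_. y)))"
      by (simp add: d ultrapower_midpoint[OF const_ell_infty const_ell_infty]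
          const_ultra_class_minkowski[OF K(1,2) nb])
    moreover have "vnorm (ultrapower U)
        (vdiff (ultrapower U) (ultra_class U (\<lambda>_. x)) (ultra_class U (\<lambda>_. y))) > \<epsilon>"
      using xy by (simp add: const_ultra_class_norm_diff[OF U])
    ultimately show "d \<in> E"
      unfolding E_def using xy ultra_class_mem[of "\<lambda>_. _" K U] by blast
  qed
  have one: "z \<in> vscale type_space 1 ` K" if "z \<in> K" for z
    using that by simp
  \<comment> \<open>Midpoints of points of \<open>K\<close> stay in \<open>K\<close>, where the
    gauge is at most 1.\<close>
  have D_bdd: "bdd_below D"
  proof (rule bdd_belowI[of _ 0])
    fix d assume "d \<in> D"
    then show "0 \<le> d"
      unfolding D_def using minkowski_le[OF zero_less_one one] convex_midpoint_mem[OF K(3)] by force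
  qed
  have E_ge: "D \<noteq> {} \<and> Inf D \<le> e" if e_mem: "e \<in> E" for e
  proof -
    obtain X Y where X: "X \<in> ultra_set U K" and Y: "Y \<in> ultra_set U K"
      and less: "vnorm (ultrapower U) (vdiff (ultrapower U) X Y) > \<epsilon>"
      and e: "e = 1 - minkowski (ultrapower U) (ultra_set U K) (vmidpoint (ultrapower U) X Y)"
      using e_mem unfolding E_def by blast
    obtain x where x: "\<And>i. x i \<in> K" "x \<in> ell_infty" "X = ultra_class U x"
      using ultra_setE[OF K(1) X] by blast
    obtain y where y: "\<And>i. y i \<in> K" "y \<in> ell_infty" "Y = ultra_class U y"
      using ultra_setE[OF K(1) Y] by blast
    have ne: "K \<noteq> {}"
      using x(1) by auto
    \<comment> \<open>0 is the midpoint of any coordinate of \<open>x\<close> and its negative;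
      \<open>undefined\<close> is just some index.\<close>
    have zero: "0 \<in> K"
      using convex_midpoint_mem[OF K(3) x(1), of "- x undefined" undefined] sym x(1) by simp
    have ev: "\<forall>\<^sub>F i in U. \<epsilon> < norm (x i - y i)"
      using eventually_ultrapower_norm_diff_less[OF U x(2) y(2)] less x y by simp
    have in_D: "1 - minkowski type_space K ((1/2) *\<^sub>R (x i + y i)) \<in> D"
      if "\<epsilon> < norm (x i - y i)" for i
      unfolding D_def using that x(1) y(1) by blast
    obtain j where j: "\<epsilon> < norm (x j - y j)"
      using eventually_happens'[OF nb ev] by blast
    have le: "minkowski type_space K ((1/2) *\<^sub>R (x i + y i)) \<le> 1 - Inf D"
      if "\<epsilon> < norm (x i - y i)" for i
      using cInf_lower[OF in_D[OF that] D_bdd] by simp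
    \<comment> \<open>Makes every \<open>t\<close> above \<open>1 - Inf D\<close> positive, as
      \<open>minkowski_le\<close> requires.\<close>
    have "0 \<le> 1 - Inf D"
      using minkowski_nonneg[OF zero_less_one one[OF convex_midpoint_mem[OF K(3) x(1)[of j] y(1)[of j]]]]
        le[OF j] by linarith
    \<comment> \<open>It suffices to treat every \<open>t\<close> above the bound: the strict
      inequality yields an actual dilate containing each relevant midpoint, and this dilate lies in
      \<open>t K\<close>.\<close>
    have "minkowski (ultrapower U) (ultra_set U K) (vmidpoint (ultrapower U) X Y) \<le> 1 - Inf D"
    proof (rule dense_ge)
      fix t assume t: "1 - Inf D < t"
      have "(1/2) *\<^sub>R (x i + y i) \<in> (*\<^sub>R) t ` K" if i: "\<epsilon> < norm (x i - y i)" for i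
      proof -
        have m: "minkowski type_space K ((1/2) *\<^sub>R (x i + y i)) < t"
          using le[OF i] t by simp
        obtain s where "0 < s" "s < t" "(1/2) *\<^sub>R (x i + y i) \<in> vscale type_space s ` K"
          by (rule minkowski_less_obtain[OF m zero_less_one one])
            (use convex_midpoint_mem[OF K(3) x(1)[of i] y(1)[of i]] in auto)
        then show ?thesis
          using scaled_convex_mono[OF K(3) zero, of s t] by simp
      qed
      then have "\<forall>\<^sub>F i in U. (1/2) *\<^sub>R (x i + y i) \<in> (*\<^sub>R) t ` K"
        using ev by (auto elim: eventually_mono)
      then have "vmidpoint (ultrapower U) X Y \<in> vscale (ultrapower U) t ` ultra_set U K"
        unfolding x(3) y(3) ultrapower_midpoint[OF x(2) y(2)]
        by (intro ultra_class_mem_scaledI K ne ell_infty_scale ell_infty_add x y)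
      then show "minkowski (ultrapower U) (ultra_set U K) (vmidpoint (ultrapower U) X Y) \<le> t"
        using t \<open>0 \<le> 1 - Inf D\<close> by (intro minkowski_le) auto
    qed
    with e in_D[OF j] show ?thesis
      by auto
  qed
  \<comment> \<open>The value 1 is assigned to the empty set by convention, so both sets must be
    empty simultaneously.\<close>
  have eq: "D = {} \<longleftrightarrow> E = {}"
    using DE E_ge by blast
  have "Inf D = Inf E" if "D \<noteq> {}"
  proof (rule antisym)
    show "Inf D \<le> Inf E"
      using E_ge eq that by (intro cInf_greatest) auto
    show "Inf E \<le> Inf D"
      by (rule cInf_superset_mono[OF that _ DE]) (use E_ge in \<open>auto intro!: bdd_belowI\<close>)
  qed
  with eq show ?thesis
    by (simp add: convexity_modulus_def D_def[symmetric] E_def[symmetric])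
qed

section \<open>Strict convexity and countable incompleteness\<close>

text \<open>Distinct classes have positive distance, so uniform convexity puts their midpoint into a
  dilate by \<open>1 - \<delta>\<close>, which bounds its gauge.\<close>

lemma uniformly_convex_ultrapower_imp_strictly_convex:
  fixes K :: "'a::real_normed_vector set"
  assumes K: "bounded K" and U: "ultrafilter U"
    and uc: "uniformly_convex (ultrapower U) (ultra_set U K)"
  shows "strictly_convex (ultrapower U) (ultra_set U K)"
  unfolding strictly_convex_def
proof (intro ballI impI; elim conjE)
  fix X Y assume X: "X \<in> ultra_set U K" and Y: "Y \<in> ultra_set U K" and neq: "X \<noteq> Y"
  obtain x where x: "x \<in> ell_infty" "X = ultra_class U x"
    using ultra_setE[OF K X] by blast
  obtain y where y: "y \<in> ell_infty" "Y = ultra_class U y"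
    using ultra_setE[OF K Y] by blast
  define d where "d = vnorm (ultrapower U) (vdiff (ultrapower U) X Y)"
  have lim: "((\<lambda>i. norm (x i - y i)) \<longlongrightarrow> d) U"
    using ultrapower_norm(2)[OF U ell_infty_diff[OF x(1) y(1)]]
    by (simp add: d_def x y ultrapower_diff)
  have "0 \<le> d"
    using U by (intro tendsto_lowerbound[OF lim]) (auto simp: ultrafilter_def)
  moreover have "d \<noteq> 0"
    using lim neq x y by (auto simp: ultra_class_eq_iff tendsto_norm_zero_iff)
  \<comment> \<open>Half the distance is taken because uniform convexity demands a distance strictly
    above its threshold.\<close>
  ultimately have "d / 2 > 0" "d > d / 2"
    by auto
  then obtain \<delta> where "0 < \<delta>" "\<delta> < 1"
    "vmidpoint (ultrapower U) X Y \<in> vscale (ultrapower U) (1 - \<delta>) ` ultra_set U K"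
    using uc X Y unfolding uniformly_convex_def d_def by meson
  then show "minkowski (ultrapower U) (ultra_set U K) (vmidpoint (ultrapower U) X Y) < 1"
    using minkowski_le[of "1 - \<delta>"] by force
qed

text \<open>Let \<open>f i\<close> be the first index of a set missing \<open>i\<close>, which
  exists because the intersection is empty. On the intersection of the first \<open>n\<close> sets,
  \<open>f\<close> is at least \<open>n\<close>.\<close>

lemma countably_incomplete_filterlim:
  assumes "countably_incomplete_ultrafilter U"
  obtains f :: "'i \<Rightarrow> nat" where "filterlim f at_top U"
proof -
  obtain A :: "nat \<Rightarrow> 'i set" where A: "\<And>n. \<forall>\<^sub>F i in U. i \<in> A n" "(\<Inter>n. A n) = {}"
    using assms unfolding countably_incomplete_ultrafilter_def by blast
  define f where "f i = (LEAST n. i \<notin> A n)" for i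
  have f: "i \<notin> A (f i)" for i
    unfolding f_def by (rule LeastI_ex) (use A(2) in auto)
  have "\<forall>\<^sub>F i in U. n \<le> f i" for n
  proof -
    have "\<forall>\<^sub>F i in U. \<forall>m\<in>{..<n}. i \<in> A m"
      using A(1) by (intro eventually_ball_finite) auto
    then show ?thesis
      by (rule eventually_mono) (use f in \<open>meson lessThan_iff not_less\<close>)
  qed
  then show ?thesis
    using that by (auto simp: filterlim_at_top)
qed

text \<open>The crux is that the midpoint \<open>M\<close> lies in no dilate by
  \<open>t < 1\<close>. This forces gauge 1 at \<open>X\<close> and \<open>Y\<close>, whereupon
  strict convexity would put \<open>M\<close> into such a dilate.\<close>

lemma strictly_convex_ultrapower_imp_uniformly_convex:
  fixes K :: "'a::real_normed_vector set"
  assumes K: "bounded K" "convex K" and int: "0 \<in> interior K"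
    and U: "countably_incomplete_ultrafilter U"
    and sc: "strictly_convex (ultrapower U) (ultra_set U K)"
  shows "uniformly_convex type_space K"
proof (rule ccontr)
  have nb: "U \<noteq> bot"
    using U by (auto simp: countably_incomplete_ultrafilter_def free_ultrafilter_def ultrafilter_def)
  obtain r where r: "r > 0" "ball 0 r \<subseteq> K"
    using int by (auto simp: mem_interior)
  have zero: "0 \<in> K"
    using int interior_subset by blast
  obtain f :: "'b \<Rightarrow> nat" where f: "filterlim f at_top U"
    using countably_incomplete_filterlim[OF U] .
  assume "\<not> uniformly_convex type_space K"
  then obtain \<epsilon> where \<epsilon>: "\<epsilon> > 0" and not_uc: "\<And>\<delta>. \<lbrakk>0 < \<delta>; \<delta> < 1\<rbrakk> \<Longrightarrow>
      \<exists>x\<in>K. \<exists>y\<in>K. norm (x - y) > \<epsilon> \<and> (1/2) *\<^sub>R (x + y) \<notin> (*\<^sub>R) (1 - \<delta>) ` K"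
    unfolding uniformly_convex_def type_space_simps by meson
  \<comment> \<open>Adding 2 keeps \<open>\<delta> i\<close> strictly below 1 even where
    \<open>f i = 0\<close>.\<close>
  define \<delta> where "\<delta> i = 1 / (real (f i) + 2)" for i
  have "\<exists>x y. x \<in> K \<and> y \<in> K \<and> norm (x - y) > \<epsilon> \<and> (1/2) *\<^sub>R (x + y) \<notin> (*\<^sub>R) (1 - \<delta> i) ` K" for i
    using not_uc[of "\<delta> i"] by (auto simp: \<delta>_def)
  then obtain x y where xK: "\<And>i. x i \<in> K" and yK: "\<And>i. y i \<in> K"
    and far: "\<And>i. norm (x i - y i) > \<epsilon>"
    and mid: "\<And>i. (1/2) *\<^sub>R (x i + y i) \<notin> (*\<^sub>R) (1 - \<delta> i) ` K"
    by metis
  have x: "x \<in> ell_infty" and y: "y \<in> ell_infty"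
    using bounded_imp_ell_infty[OF K(1)] xK yK by blast+
  define X Y M where "X = ultra_class U x" and "Y = ultra_class U y"
    and "M = vmidpoint (ultrapower U) X Y"
  have XK: "X \<in> ultra_set U K" and YK: "Y \<in> ultra_set U K"
    using xK yK by (simp_all add: X_def Y_def ultra_class_mem)
  have m: "(\<lambda>i. (1/2) *\<^sub>R (x i + y i)) \<in> ell_infty"
    by (intro ell_infty_scale ell_infty_add x y)
  have M: "M = ultra_class U (\<lambda>i. (1/2) *\<^sub>R (x i + y i))"
    by (simp add: M_def X_def Y_def ultrapower_midpoint x y)
  have "X \<noteq> Y"
  proof
    assume "X = Y"
    then have "((\<lambda>i. norm (x i - y i)) \<longlongrightarrow> 0) U"
      by (simp add: X_def Y_def ultra_class_eq_iff x y tendsto_norm_zero_iff)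
    then have "\<epsilon> \<le> 0"
      using far by (intro tendsto_lowerbound[OF _ _ nb] always_eventually) (auto intro: less_imp_le)
    with \<epsilon> show False
      by simp
  qed
  have M_outside: "M \<notin> vscale (ultrapower U) t ` ultra_set U K" if t: "0 < t" "t < 1" for t
  proof
    assume "M \<in> vscale (ultrapower U) t ` ultra_set U K"
    then obtain w where w: "\<And>i. w i \<in> K"
      and lim: "((\<lambda>i. (1/2) *\<^sub>R (x i + y i) - t *\<^sub>R w i) \<longlongrightarrow> 0) U"
      by (auto simp: M ultra_class_mem_scaled_iff[OF K(1) m])
    \<comment> \<open>Half the gap between \<open>t\<close> and 1: one half is spent on absorbing
      the error, the other leaves room for \<open>\<delta> i\<close>.\<close>
    define s where "s = (1 - t) / 2"
    have s: "0 < s" "t + s = 1 - s"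
      using t by (auto simp: s_def field_simps)
    have "\<forall>\<^sub>F i in U. norm ((1/2) *\<^sub>R (x i + y i) - t *\<^sub>R w i) < s * r"
      using tendstoD[OF lim, of "s * r"] s r by simp
    moreover have "\<forall>\<^sub>F i in U. nat \<lceil>1 / s\<rceil> \<le> f i"
      using f unfolding filterlim_at_top by blast
    ultimately have "\<forall>\<^sub>F i in U. False"
    proof eventually_elim
      case (elim i)
      \<comment> \<open>The error divided by \<open>s\<close>; its norm is below \<open>r\<close>,
        so it lies in the ball contained in \<open>K\<close>.\<close>
      define k where "k = inverse s *\<^sub>R ((1/2) *\<^sub>R (x i + y i) - t *\<^sub>R w i)"
      have "norm k < r"
        using elim(1) s unfolding k_def norm_scaleR by (simp add: field_simps)
      then have "k \<in> K"
        using r by auto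
      have "1 / s \<le> real (f i) + 2"
        using elim(2) by linarith
      \<comment> \<open>Consequently the dilate by \<open>1 - s\<close> lies inside the one by
        \<open>1 - \<delta> i\<close>, which \<open>mid\<close> excludes.\<close>
      then have "\<delta> i \<le> s"
        using s by (simp add: \<delta>_def field_simps)
      have "(1/2) *\<^sub>R (x i + y i) = t *\<^sub>R w i + s *\<^sub>R k"
        using s by (simp add: k_def)
      then have "(1/2) *\<^sub>R (x i + y i) \<in> (*\<^sub>R) (1 - s) ` K"
        using scaled_convex_add[OF K(2) t(1) s(1) w \<open>k \<in> K\<close>] s(2) by metis
      then have "(1/2) *\<^sub>R (x i + y i) \<in> (*\<^sub>R) (1 - \<delta> i) ` K"
        by (rule scaled_convex_mono[OF K(2) zero, rotated -1])
          (use \<open>\<delta> i \<le> s\<close> t in \<open>auto simp: s_def\<close>)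
      with mid show False
        by blast
    qed
    with nb show False
      by (simp add: eventually_False)
  qed
  \<comment> \<open>If \<open>p\<close> were in a dilate by \<open>t < 1\<close>, averaging with
    \<open>q\<close> would put \<open>M\<close> into the dilate by \<open>(t + 1) / 2\<close>. The
    families \<open>p\<close> and \<open>q\<close> are left general so that \<open>x\<close> and
    \<open>y\<close> can be used in either order.\<close>
  have gauge_one: "minkowski (ultrapower U) (ultra_set U K) (ultra_class U p) = 1"
    if pK: "\<And>i. p i \<in> K" and qK: "\<And>i. q i \<in> K"
      and Mpq: "M = ultra_class U (\<lambda>i. (1/2) *\<^sub>R (p i + q i))" for p q
  proof (rule ccontr)
    assume ne: "minkowski (ultrapower U) (ultra_set U K) (ultra_class U p) \<noteq> 1"
    have p: "p \<in> ell_infty" and q: "q \<in> ell_infty"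
      using bounded_imp_ell_infty[OF K(1)] pK qK by blast+
    have P1: "ultra_class U p \<in> vscale (ultrapower U) 1 ` ultra_set U K"
      using ultra_set_scale_one[OF K(1) ultra_class_mem[of p K U]] pK by blast
    have "minkowski (ultrapower U) (ultra_set U K) (ultra_class U p) < 1"
      using minkowski_le[OF zero_less_one P1] ne by simp
    then obtain t where t: "0 < t" "t < 1"
      and "ultra_class U p \<in> vscale (ultrapower U) t ` ultra_set U K"
      using minkowski_less_obtain[OF _ zero_less_one P1] by blast
    then obtain u where u: "\<And>i. u i \<in> K" and lim: "((\<lambda>i. p i - t *\<^sub>R u i) \<longlongrightarrow> 0) U"
      by (auto simp: ultra_class_mem_scaled_iff[OF K(1) p])
    have "\<exists>v. v \<in> K \<and> (t/2) *\<^sub>R u i + (1/2) *\<^sub>R q i = (t/2 + 1/2) *\<^sub>R v" for i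
      using scaled_convex_add[OF K(2) _ _ u qK, of "t/2" "1/2"] t by auto
    then obtain v where v: "\<And>i. v i \<in> K"
      "\<And>i. (t/2) *\<^sub>R u i + (1/2) *\<^sub>R q i = (t/2 + 1/2) *\<^sub>R v i"
      by metis
    \<comment> \<open>Replacing \<open>p\<close> by \<open>t *\<^sub>R u\<close> costs the midpoint
      only half of an error tending to 0.\<close>
    have eq: "(1/2) *\<^sub>R (p i + q i) - (t/2 + 1/2) *\<^sub>R v i = (1/2) *\<^sub>R (p i - t *\<^sub>R u i)" for i
      unfolding v(2)[symmetric] by (simp add: algebra_simps)
    have "((\<lambda>i. (1/2) *\<^sub>R (p i - t *\<^sub>R u i)) \<longlongrightarrow> (1/2) *\<^sub>R 0) U"
      by (intro tendsto_intros lim)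
    then have "((\<lambda>i. (1/2) *\<^sub>R (p i + q i) - (t/2 + 1/2) *\<^sub>R v i) \<longlongrightarrow> 0) U"
      unfolding eq by simp
    then have "M \<in> vscale (ultrapower U) (t/2 + 1/2) ` ultra_set U K"
      unfolding Mpq using v(1)
      by (subst ultra_class_mem_scaled_iff[OF K(1) ell_infty_scale[OF ell_infty_add[OF p q]]]) blast
    with M_outside[of "t/2 + 1/2"] t show False
      by simp
  qed
  have "minkowski (ultrapower U) (ultra_set U K) X = 1"
    unfolding X_def by (rule gauge_one[OF xK yK M])
  moreover have "minkowski (ultrapower U) (ultra_set U K) Y = 1"
    unfolding Y_def by (rule gauge_one[where q = x]) (simp_all add: xK yK M add.commute)
  ultimately have less: "minkowski (ultrapower U) (ultra_set U K) M < 1"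
    using sc XK YK \<open>X \<noteq> Y\<close> unfolding strictly_convex_def M_def by blast
  have "M \<in> ultra_set U K"
    unfolding M by (rule ultra_class_mem) (rule convex_midpoint_mem[OF K(2) xK yK])
  then obtain t where "0 < t" "t < 1" "M \<in> vscale (ultrapower U) t ` ultra_set U K"
    using minkowski_less_obtain[OF less zero_less_one ultra_set_scale_one[OF K(1)]] by blast
  with M_outside show False
    by blast
qed

theorem proposition4p7:
  fixes K :: "'a::banach set" and U :: "'i filter"
  assumes symmetric: "\<forall>x\<in>K. - x \<in> K"
    and "bounded K" and "closed K" and "convex K"
    and "infinite (UNIV :: 'i set)"
    and "countably_incomplete_ultrafilter U"
  shows "(uniformly_convex type_space K \<longleftrightarrow> uniformly_convex (ultrapower U) (ultra_set U K))
    \<and> (uniformly_convex type_space K \<longrightarrow>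
        (\<forall>\<epsilon>>0. convexity_modulus type_space K \<epsilon>
              = convexity_modulus (ultrapower U) (ultra_set U K) \<epsilon>))
    \<and> (0 \<in> interior K \<longrightarrow>
        (uniformly_convex type_space K \<longleftrightarrow> strictly_convex (ultrapower U) (ultra_set U K))
        \<and> (uniformly_convex (ultrapower U) (ultra_set U K)
             \<longleftrightarrow> strictly_convex (ultrapower U) (ultra_set U K)))"
proof -
  have U: "ultrafilter U"
    using assms(6) by (simp add: countably_incomplete_ultrafilter_def free_ultrafilter_def)
  have uc: "uniformly_convex (ultrapower U) (ultra_set U K) \<longleftrightarrow> uniformly_convex type_space K"
    by (rule uniformly_convex_ultrapower_iff[OF assms(2,3) U])
  have mod: "convexity_modulus type_space K \<epsilon> = convexity_modulus (ultrapower U) (ultra_set U K) \<epsilon>" for \<epsilon>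
    by (rule convexity_modulus_ultrapower[OF assms(1-4) U, symmetric])
  \<comment> \<open>Closes the cycle: \<open>K\<close> uniformly convex,
    \<open>ultra_set U K\<close> uniformly convex, \<open>ultra_set U K\<close> strictly convex, and
    back to \<open>K\<close>.\<close>
  have sc: "uniformly_convex type_space K \<longleftrightarrow> strictly_convex (ultrapower U) (ultra_set U K)"
    if "0 \<in> interior K"
    using uniformly_convex_ultrapower_imp_strictly_convex[OF assms(2) U]
      strictly_convex_ultrapower_imp_uniformly_convex[OF assms(2,4) that assms(6)] uc
    by blast
  show ?thesis
    using uc mod sc by simp
qed

end
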